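(* Let $n\ge 3$, $\lambda=(1,n-1)$, and let $h:[n]\to[n]$ be a connected Hessenberg function such that $$|\{i: i<n-1,\ h(i)\ge n-1\}|=|\{i: i<n,\ h(i)=n\}|$$ and $h(1)<n-1$. For $0\le i\le n-1$ let $u_i=s_1s_2\cdots s_i$ ($u_0=e$), $f_i=u_i^{-1}\cdot f^{(n-2)}_\lambda$ and $g_i=u_i^{-1}\cdot f^{(n-1)}_\lambda$. Suppose $\deg f_0=\deg g_0\ge 2$. Then the set $\{f_0,\dots,f_{n-1},g_0,\dots,g_{n-1}\}$ (the union of the $S_n$-orbits of $f_0$ and $g_0$ under the dot action) is linearly independent over $H^*_T(\mathrm{pt})=\mathbb{C}[t_1,\dots,t_n]$.
   Context: Notation: $[n]=\{1,\dots,n\}$. A Hessenberg function is a nondecreasing $h:[n]\to[n]$ with $h(i)\ge i$; it is connected if $h(i)>i$ for all $i\in[n-1]$. $S_n$ acts on $\mathbb{C}[t_1,\dots,t_n]$ with $v(t_i)=t_{v(i)}$. $\Phi^-=\{t_i-t_j:i>j\}$, $\Phi^+=\{t_i-t_j:i<j\}$, $\Phi_h^-=\{t_i-t_j:i>j,\ i\le h(j)\}$, $N^-(w)=\{\gamma\in\Phi^-:w(\gamma)\in\Phi^+\}$, $N_h^-(w)=N^-(w)\cap\Phi_h^-$; $s_\gamma$ is the transposition of $i,j$ for $\gamma=t_i-t_j$, and $s_i$ the transposition of $i,i+1$. For regular semisimple $\mathsf S$, $H^*_T(\mathrm{Hess}(\mathsf S,h))$ (complex coefficients, $T$ the diagonal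 torus) is identified via GKM theory with tuples $(f(w))_{w\in S_n}$ of polynomials such that for every $w$ and $\gamma=t_i-t_j\in N_h^-(w)$, $t_{w(i)}-t_{w(j)}$ divides $f(w)-f(ws_\gamma)$; it is a $\mathbb{C}[t_1,\dots,t_n]$-module componentwise. Dot action: $(v\cdot f)(w)=v(f(v^{-1}w))$. Bruhat order is $\le$. For $\lambda=(1,n-1)$: $S_\lambda$ is the stabilizer of $1$ in $S_n$; ${}^\lambda S_n=\{u_0,\dots,u_{n-1}\}$ where $u_k$ has one-line notation $[2,3,\dots,k+1,1,k+2,\dots,n]$; each $w$ is uniquely $yu_k$ with $y\in S_\lambda$. Put $\mathcal S_k=\{t_a-t_b: a<b,\ u_k^{-1}(a)>u_k^{-1}(b),\ u_k^{-1}(a)\le h(u_k^{-1}(b))\}$ and $f^{(k)}_\lambda(yu_m)=\prod_{t_a-t_b\in\mathcal S_k}(t_{y(a)}-t_{y(b)})$ if $u_m\ge u_k$ and $0$ otherwise ($y\in S_\lambda$). These are GKM classes. The degree $\deg f^{(k)}_\lambda$ means the polynomial degree $|\mathcal S_k|$ of its nonzero entries. *)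

theory Defs
  imports Complex_Main "HOL-Library.Poly_Mapping" "HOL-Combinatorics.Permutations"
begin

text \<open>
  Permutations of \<open>[n]\<close> are functions \<open>w :: nat \<Rightarrow> nat\<close> with \<open>w permutes {1..n}\<close>; the product
  is composition. A root \<open>t\<^sub>i - t\<^sub>j\<close> is represented by the pair \<open>(i, j)\<close>.
\<close>

subsection \<open>The polynomial ring and the action of permutations\<close>

text \<open>
  Polynomials with complex coefficients in the variables \<open>t\<^sub>i\<close>, \<open>i :: nat\<close>; the ring
  \<open>\<complex>[t\<^sub>1,\<dots>,t\<^sub>n]\<close> is the subring of those in which only \<open>t\<^sub>1,\<dots>,t\<^sub>n\<close> occur.
\<close>

type_synonym cpoly = "(nat \<Rightarrow>\<^sub>0 nat) \<Rightarrow>\<^sub>0 complex"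

definition tvar :: "nat \<Rightarrow> cpoly" where
  "tvar i = Poly_Mapping.single (Poly_Mapping.single i 1) 1"

definition poly_ring :: "nat \<Rightarrow> cpoly set" where
  "poly_ring n = {p. \<forall>m \<in> Poly_Mapping.keys p. Poly_Mapping.keys m \<subseteq> {1..n}}"

definition mdeg :: "(nat \<Rightarrow>\<^sub>0 nat) \<Rightarrow> nat" where
  "mdeg m = (\<Sum>i\<in>Poly_Mapping.keys m. Poly_Mapping.lookup m i)"

text \<open>Total degree, with the convention that \<open>0\<close> has degree \<open>0\<close>.\<close>

definition tdeg :: "cpoly \<Rightarrow> nat" where
  "tdeg p = Max (insert 0 (mdeg ` Poly_Mapping.keys p))"

text \<open>
  For a permutation \<open>v\<close>, the coefficient of \<open>v(p)\<close> at a monomial \<open>m\<close> is that of \<open>p\<close> at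
  \<open>m \<circ> v = v\<^sup>-\<^sup>1(m)\<close>. The lemmas below show that \<open>perm_act v\<close> is the algebra homomorphism
  with \<open>t\<^sub>i \<mapsto> t\<^bsub>v(i)\<^esub>\<close>.
\<close>

definition perm_act :: "(nat \<Rightarrow> nat) \<Rightarrow> cpoly \<Rightarrow> cpoly" where
  "perm_act v p = Poly_Mapping.map_key (Poly_Mapping.map_key v) p"

lemma inj_map_key:
  assumes "bij v"
  shows "inj (Poly_Mapping.map_key v :: (nat \<Rightarrow>\<^sub>0 'b::zero) \<Rightarrow> _)"
proof (rule injI)
  fix x y :: "nat \<Rightarrow>\<^sub>0 'b"
  assume "Poly_Mapping.map_key v x = Poly_Mapping.map_key v y"
  then have "Poly_Mapping.lookup x (v k) = Poly_Mapping.lookup y (v k)" for k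
    using assms by (metis bij_is_inj map_key.rep_eq comp_apply)
  then show "x = y"
    using assms by (metis bij_is_surj poly_mapping_eqI surj_def)
qed

lemma perm_act_single:
  assumes "bij v"
  shows "perm_act v (Poly_Mapping.single m a) = Poly_Mapping.single (Poly_Mapping.map_key (inv v) m) a"
proof -
  have "Poly_Mapping.map_key v (Poly_Mapping.map_key (inv v) m) = m"
    using assms by (intro poly_mapping_eqI)
      (simp add: map_key.rep_eq bij_is_inj bij_imp_bij_inv)
  then show ?thesis
    using map_key_single[OF inj_map_key[OF assms], of "Poly_Mapping.map_key (inv v) m" a]
    by (simp add: perm_act_def)
qed

lemma perm_act_tvar: "bij v \<Longrightarrow> perm_act v (tvar i) = tvar (v i)"
  using map_key_single[OF bij_is_inj[OF bij_imp_bij_inv], of v "v i" "1::nat"]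
  by (simp add: tvar_def perm_act_single bij_is_inj)

lemma perm_act_const: "bij v \<Longrightarrow> perm_act v (Poly_Mapping.single 0 c) = Poly_Mapping.single 0 c"
  by (simp add: perm_act_single bij_is_inj bij_imp_bij_inv)

lemma perm_act_add: "bij v \<Longrightarrow> perm_act v (p + q) = perm_act v p + perm_act v q"
  unfolding perm_act_def by (rule map_key_plus[OF inj_map_key])

lemma perm_act_sum: "bij v \<Longrightarrow> perm_act v (\<Sum>x\<in>A. p x) = (\<Sum>x\<in>A. perm_act v (p x))"
  by (induction A rule: infinite_finite_induct)
    (simp_all add: perm_act_add perm_act_def[of v 0] inj_map_key)

lemma cpoly_expand: "(p :: cpoly) = (\<Sum>m\<in>Poly_Mapping.keys p. Poly_Mapping.single m (Poly_Mapping.lookup p m))"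
  by (rule poly_mapping_eqI)
    (auto simp: lookup_sum lookup_single when_def in_keys_iff)

lemma perm_act_mult:
  assumes "bij v"
  shows "perm_act v (p * q) = perm_act v p * perm_act v q"
proof -
  have 1: "perm_act v (Poly_Mapping.single m a * Poly_Mapping.single m' b)
      = perm_act v (Poly_Mapping.single m a) * perm_act v (Poly_Mapping.single m' b)" for m m' a b
    using assms map_key_plus[OF bij_is_inj[OF bij_imp_bij_inv[OF assms]], of m m']
    by (simp add: perm_act_single mult_single)
  have "perm_act v ((\<Sum>m\<in>A. Poly_Mapping.single m (f m)) * (\<Sum>m\<in>B. Poly_Mapping.single m (g m)))
     = perm_act v (\<Sum>m\<in>A. Poly_Mapping.single m (f m)) * perm_act v (\<Sum>m\<in>B. Poly_Mapping.single m (g m))"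
     for A B f g
    by (simp add: sum_product perm_act_sum assms 1)
  then show ?thesis
    using cpoly_expand[of p] cpoly_expand[of q] by metis
qed

subsection \<open>Hessenberg functions and GKM classes\<close>

definition hessenberg :: "nat \<Rightarrow> (nat \<Rightarrow> nat) \<Rightarrow> bool" where
  "hessenberg n h \<longleftrightarrow> h ` {1..n} \<subseteq> {1..n} \<and> mono_on {1..n} h \<and> (\<forall>i\<in>{1..n}. i \<le> h i)"

definition hess_connected :: "nat \<Rightarrow> (nat \<Rightarrow> nat) \<Rightarrow> bool" where
  "hess_connected n h \<longleftrightarrow> (\<forall>i\<in>{1..n-1}. i < h i)"

text \<open>\<open>N\<^sub>h\<^sup>-(w)\<close>: negative roots \<open>t\<^sub>i - t\<^sub>j\<close> of \<open>\<Phi>\<^sub>h\<^sup>-\<close> sent by \<open>w\<close> to positive roots.\<close>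

definition Nh_minus :: "nat \<Rightarrow> (nat \<Rightarrow> nat) \<Rightarrow> (nat \<Rightarrow> nat) \<Rightarrow> (nat \<times> nat) set" where
  "Nh_minus n h w = {(i, j). i \<in> {1..n} \<and> j \<in> {1..n} \<and> i > j \<and> i \<le> h j \<and> w i < w j}"

text \<open>
  A tuple \<open>(f(w))\<close> indexed by the permutations of \<open>[n]\<close> is a function on \<open>nat \<Rightarrow> nat\<close> that
  is \<open>0\<close> outside the permutations, so that equality of functions is equality of tuples.
\<close>

type_synonym tuple = "(nat \<Rightarrow> nat) \<Rightarrow> cpoly"

definition gkm :: "nat \<Rightarrow> (nat \<Rightarrow> nat) \<Rightarrow> tuple set" where
  "gkm n h = {f.
     (\<forall>w. \<not> w permutes {1..n} \<longrightarrow> f w = 0) \<and>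
     (\<forall>w. w permutes {1..n} \<longrightarrow> f w \<in> poly_ring n) \<and>
     (\<forall>w. w permutes {1..n} \<longrightarrow> (\<forall>(i, j) \<in> Nh_minus n h w.
        \<exists>q\<in>poly_ring n. f w - f (w \<circ> transpose i j) = (tvar (w i) - tvar (w j)) * q))}"

definition dot :: "nat \<Rightarrow> (nat \<Rightarrow> nat) \<Rightarrow> tuple \<Rightarrow> tuple" where
  "dot n v f = (\<lambda>w. if w permutes {1..n} then perm_act v (f (inv v \<circ> w)) else 0)"

definition orbit :: "nat \<Rightarrow> tuple \<Rightarrow> tuple set" where
  "orbit n f = {dot n v f | v. v permutes {1..n}}"

text \<open>Linear independence over \<open>\<complex>[t\<^sub>1,\<dots>,t\<^sub>n]\<close> of a finite family of tuples.\<close>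

definition lin_independent :: "nat \<Rightarrow> 'i set \<Rightarrow> ('i \<Rightarrow> tuple) \<Rightarrow> bool" where
  "lin_independent n I b \<longleftrightarrow>
     (\<forall>c. (\<forall>i\<in>I. c i \<in> poly_ring n) \<and>
          (\<forall>w. w permutes {1..n} \<longrightarrow> (\<Sum>i\<in>I. c i * b i w) = 0)
        \<longrightarrow> (\<forall>i\<in>I. c i = 0))"

subsection \<open>Bruhat order\<close>

definition perm_length :: "nat \<Rightarrow> (nat \<Rightarrow> nat) \<Rightarrow> nat" where
  "perm_length n w = card {(i, j). i \<in> {1..n} \<and> j \<in> {1..n} \<and> i < j \<and> w i > w j}"

definition bruhat_step :: "nat \<Rightarrow> (nat \<Rightarrow> nat) \<Rightarrow> (nat \<Rightarrow> nat) \<Rightarrow> bool" where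
  "bruhat_step n u w \<longleftrightarrow>
     (\<exists>i\<in>{1..n}. \<exists>j\<in>{1..n}. w = u \<circ> transpose i j \<and> perm_length n u < perm_length n w)"

definition bruhat_le :: "nat \<Rightarrow> (nat \<Rightarrow> nat) \<Rightarrow> (nat \<Rightarrow> nat) \<Rightarrow> bool" where
  "bruhat_le n = (bruhat_step n)\<^sup>*\<^sup>*"

subsection \<open>The classes for \<open>\<lambda> = (1, n - 1)\<close>\<close>

text \<open>\<open>u\<^sub>k = s\<^sub>1 s\<^sub>2 \<cdots> s\<^sub>k\<close>, where \<open>s\<^sub>i\<close> interchanges \<open>i\<close> and \<open>i + 1\<close>.\<close>

primrec u_perm :: "nat \<Rightarrow> nat \<Rightarrow> nat" where
  "u_perm 0 = id"
| "u_perm (Suc k) = u_perm k \<circ> transpose (Suc k) (Suc (Suc k))"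

lemma u_perm_one_line:
  "u_perm k i = (if i \<in> {1..k} then Suc i else if i = Suc k then 1 else i)"
  by (induction k arbitrary: i) (auto simp: transpose_def)

lemma u_perm_permutes: "k < n \<Longrightarrow> u_perm k permutes {1..n}"
proof (induction k)
  case (Suc k)
  then show ?case
    unfolding u_perm.simps by (intro permutes_compose permutes_swap_id) auto
qed (simp add: permutes_id)

lemma bij_u_perm: "bij (u_perm k)"
  using u_perm_permutes[of k "Suc k"] by (auto intro: permutes_bij)

definition stab_one :: "nat \<Rightarrow> (nat \<Rightarrow> nat) set" where
  "stab_one n = {y. y permutes {1..n} \<and> y 1 = 1}"

text \<open>The unique \<open>(y, m)\<close> with \<open>w = y u\<^sub>m\<close>, \<open>y \<in> S\<^sub>\<lambda>\<close> and \<open>m < n\<close>.\<close>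

definition coset_decomp :: "nat \<Rightarrow> (nat \<Rightarrow> nat) \<Rightarrow> (nat \<Rightarrow> nat) \<times> nat" where
  "coset_decomp n w = (THE (y, m). y \<in> stab_one n \<and> m < n \<and> w = y \<circ> u_perm m)"

definition S_set :: "nat \<Rightarrow> (nat \<Rightarrow> nat) \<Rightarrow> nat \<Rightarrow> (nat \<times> nat) set" where
  "S_set n h k = {(a, b). a \<in> {1..n} \<and> b \<in> {1..n} \<and> a < b \<and>
     inv (u_perm k) a > inv (u_perm k) b \<and> inv (u_perm k) a \<le> h (inv (u_perm k) b)}"

definition f_class :: "nat \<Rightarrow> (nat \<Rightarrow> nat) \<Rightarrow> nat \<Rightarrow> tuple" where
  "f_class n h k = (\<lambda>w. if w permutes {1..n} then
     (let (y, m) = coset_decomp n w in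
        if bruhat_le n (u_perm k) (u_perm m)
        then \<Prod>(a, b)\<in>S_set n h k. tvar (y a) - tvar (y b) else 0)
     else 0)"

text \<open>All nonzero entries of a class \<open>f_class n h k\<close> and of its images under the dot action
  have the same degree, so the maximum is this common degree.\<close>

definition class_degree :: "nat \<Rightarrow> tuple \<Rightarrow> nat" where
  "class_degree n f = Max ((\<lambda>w. tdeg (f w)) ` {w. w permutes {1..n}})"

lemma coset_decomp_exists:
  assumes w: "w permutes {1..n}" and n: "0 < n"
  shows "\<exists>y m. y \<in> stab_one n \<and> m < n \<and> w = y \<circ> u_perm m"
proof -
  obtain p where p: "p \<in> {1..n}" "w p = 1"
    using w n by (metis One_nat_def Suc_leI atLeastAtMost_iff le_refl permutes_inverses(1) permutes_inv permutes_in_image)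
  define m where "m = p - 1"
  have m: "m < n" "p = Suc m" using p by (auto simp: m_def)
  have "w \<circ> inv (u_perm m) permutes {1..n}"
    using w u_perm_permutes[OF m(1)] by (intro permutes_compose permutes_inv)
  moreover have "inv (u_perm m) 1 = p"
    using bij_u_perm[of m] m(2) by (intro inv_f_eq) (auto simp: bij_is_inj u_perm_one_line)
  ultimately have "w \<circ> inv (u_perm m) \<in> stab_one n" using p by (simp add: stab_one_def)
  moreover have "w = (w \<circ> inv (u_perm m)) \<circ> u_perm m"
    using bij_u_perm[of m] by (simp add: fun_eq_iff bij_is_inj)
  ultimately show ?thesis using m by blast
qed

lemma coset_decomp_unique:
  assumes "y \<in> stab_one n" "y' \<in> stab_one n" "y \<circ> u_perm m = y' \<circ> u_perm m'"
  shows "y = y' \<and> m = m'"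
proof -
  have y: "inj y" "inj y'" "y 1 = 1" "y' 1 = 1"
    using assms by (auto simp: stab_one_def permutes_inj)
  have "y' (u_perm m' (Suc m)) = y (u_perm m (Suc m))"
    using assms(3) by (metis comp_apply)
  then have "y' (u_perm m' (Suc m)) = y' 1" using y by (simp add: u_perm_one_line)
  then have "u_perm m' (Suc m) = 1" using y by (metis injD)
  then have "m = m'" by (auto simp: u_perm_one_line split: if_splits)
  then show ?thesis using assms(3) bij_u_perm[of m]
    by (metis bij_is_surj fun.map_comp surj_iff comp_id comp_assoc)
qed

lemma coset_decomp_eq:
  assumes "y \<in> stab_one n" "m < n"
  shows "coset_decomp n (y \<circ> u_perm m) = (y, m)"
  unfolding coset_decomp_def
  using assms by (intro the_equality) (auto dest: coset_decomp_unique[OF assms(1)])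

lemma f_class_apply:
  assumes "y \<in> stab_one n" "m < n"
  shows "f_class n h k (y \<circ> u_perm m) =
    (if bruhat_le n (u_perm k) (u_perm m)
     then \<Prod>(a, b)\<in>S_set n h k. tvar (y a) - tvar (y b) else 0)"
proof -
  have "y \<circ> u_perm m permutes {1..n}"
    using assms u_perm_permutes by (auto simp: stab_one_def intro: permutes_compose)
  then show ?thesis by (simp add: f_class_def coset_decomp_eq assms)
qed

lemma mdeg_add: "mdeg (a + b) = mdeg a + mdeg b"
  unfolding mdeg_def by (rule setsum_keys_plus_distrib) auto

lemma tdeg_homogeneous:
  assumes "p \<noteq> 0" "\<And>m. m \<in> Poly_Mapping.keys p \<Longrightarrow> mdeg m = d"
  shows "tdeg p = d"
proof -
  have "mdeg ` Poly_Mapping.keys p = (\<lambda>_. d) ` Poly_Mapping.keys p"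
    using assms(2) by (intro image_cong) auto
  also have "\<dots> = {d}"
    using assms(1) by (simp add: image_constant_conv)
  finally show ?thesis unfolding tdeg_def by simp
qed

lemma linear_homogeneous:
  "m \<in> Poly_Mapping.keys (tvar i - tvar j) \<Longrightarrow> mdeg m = 1"
  using keys_diff[of "tvar i" "tvar j"] by (auto simp: tvar_def mdeg_def)

lemma prod_linear_homogeneous:
  "finite A \<Longrightarrow> m \<in> Poly_Mapping.keys (\<Prod>(a, b)\<in>A. tvar (y a) - tvar (y b)) \<Longrightarrow> mdeg m = card A"
proof (induction A arbitrary: m rule: finite_induct)
  case empty
  then show ?case by (simp add: mdeg_def)
next
  case (insert x A)
  obtain a b where x: "x = (a, b)" by fastforce
  have "m \<in> Poly_Mapping.keys ((tvar (y a) - tvar (y b)) * (\<Prod>(a, b)\<in>A. tvar (y a) - tvar (y b)))"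
    using insert.prems insert.hyps by (simp add: x)
  then obtain m1 m2 where "m = m1 + m2" "m1 \<in> Poly_Mapping.keys (tvar (y a) - tvar (y b))"
      "m2 \<in> Poly_Mapping.keys (\<Prod>(a, b)\<in>A. tvar (y a) - tvar (y b))"
    using keys_mult by blast
  then show ?case using insert.IH insert.hyps linear_homogeneous by (simp add: mdeg_add)
qed

lemma tvar_inj: "tvar i = tvar j \<Longrightarrow> i = j"
  unfolding tvar_def by (metis keys_single one_neq_zero singleton_inject)

lemma f_class_degree:
  assumes "k < n"
  shows "class_degree n (f_class n h k) = card (S_set n h k)"
proof -
  have fin: "finite (S_set n h k)"
    by (rule finite_subset[of _ "{1..n} \<times> {1..n}"]) (auto simp: S_set_def)
  have prodnz: "(\<Prod>(a, b)\<in>S_set n h k. tvar (y a) - tvar (y b)) \<noteq> 0" if "inj y" for y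
    using fin that by (auto simp: S_set_def dest!: tvar_inj dest: injD)
  have deg: "tdeg (f_class n h k w) = (if f_class n h k w = 0 then 0 else card (S_set n h k))"
    if w: "w permutes {1..n}" for w
  proof (cases "f_class n h k w = 0")
    case True
    then show ?thesis by (simp add: tdeg_def)
  next
    case False
    obtain y m where "y \<in> stab_one n" "m < n" "w = y \<circ> u_perm m"
      using coset_decomp_exists[OF w] assms by auto
    then show ?thesis
      using False prod_linear_homogeneous[OF fin]
      by (auto simp: f_class_apply intro!: tdeg_homogeneous split: if_splits)
  qed
  have id: "id \<in> stab_one n" by (simp add: stab_one_def permutes_id)
  have uk: "u_perm k permutes {1..n}" using assms by (rule u_perm_permutes)
  have "f_class n h k (id \<circ> u_perm k) \<noteq> 0"
    using prodnz[of id] f_class_apply[OF id assms, of h k] by (simp add: bruhat_le_def)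
  then have "card (S_set n h k) \<in> (\<lambda>w. tdeg (f_class n h k w)) ` {w. w permutes {1..n}}"
    using deg[OF uk] uk by (auto simp: image_iff intro!: exI[of _ "u_perm k"])
  then show ?thesis
    unfolding class_degree_def
    using finite_permutations[of "{1..n}"] deg by (intro Max_eqI) (auto split: if_splits)
qed

end

theory Submission
  imports Defs
begin

text \<open>
  The image of \<open>f\<^sup>(\<^sup>k\<^sup>)\<close> under \<open>v\<close> depends only on \<open>r = v(1)\<close>: its value at \<open>w\<close> is
  \<open>\<Prod>\<^sub>c (t\<^sub>r - t\<^bsub>w(c)\<^esub>)\<close>, over the \<open>c \<le> k\<close> with \<open>h(c) > k\<close>, when \<open>w\<^sup>-\<^sup>1(r) > k\<close>, and \<open>0\<close> otherwise.
  Let \<open>d\<close> be the common degree and \<open>p = w(n-1)\<close>, \<open>q = w(n)\<close>, \<open>x = w(n-1-d)\<close>, \<open>c = w(n-2)\<close>,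
  \<open>z = w(1)\<close>. A linear relation evaluated at \<open>w\<close> has the form
  \<open>\<alpha> (t\<^sub>p - t\<^sub>c) (t\<^sub>p - t\<^sub>x) + \<beta> (t\<^sub>q - t\<^sub>c) (t\<^sub>q - t\<^sub>x) + \<gamma> (t\<^sub>q - t\<^sub>c) = 0\<close>, where \<open>\<beta>\<close> and \<open>\<gamma>\<close>
  are nonzero multiples of the two coefficients at \<open>r = q\<close>, and \<open>\<alpha>\<close>, \<open>\<beta>\<close>, \<open>\<gamma>\<close> do not change when \<open>x\<close>, \<open>c\<close>, \<open>z\<close> are permuted; \<open>d \<ge> 2\<close> and \<open>h(1) < n-1\<close> make these positions distinct.
  Comparing the relations for the permuted letters forces \<open>\<beta> = \<gamma> = 0\<close>.
\<close>

subsection \<open>Polynomials\<close>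

lemma poly_ring_add: "p \<in> poly_ring n \<Longrightarrow> q \<in> poly_ring n \<Longrightarrow> p + q \<in> poly_ring n"
  using keys_add[of p q] by (auto simp: poly_ring_def)

lemma poly_ring_diff: "p \<in> poly_ring n \<Longrightarrow> q \<in> poly_ring n \<Longrightarrow> p - q \<in> poly_ring n"
  using keys_diff[of p q] by (auto simp: poly_ring_def)

lemma poly_ring_mult:
  assumes "p \<in> poly_ring n" "q \<in> poly_ring n"
  shows "p * q \<in> poly_ring n"
  unfolding poly_ring_def
proof (intro CollectI ballI)
  fix m assume "m \<in> Poly_Mapping.keys (p * q)"
  then obtain a b where "m = a + b" "a \<in> Poly_Mapping.keys p" "b \<in> Poly_Mapping.keys q"
    using keys_mult[of p q] by blast
  then show "Poly_Mapping.keys m \<subseteq> {1..n}"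
    using assms keys_add[of a b] unfolding poly_ring_def by fastforce
qed

lemma poly_ring_0: "0 \<in> poly_ring n"
  by (simp add: poly_ring_def)

lemma poly_ring_1: "1 \<in> poly_ring n"
  by (simp add: poly_ring_def)

lemma poly_ring_tvar: "i \<in> {1..n} \<Longrightarrow> tvar i \<in> poly_ring n"
  by (simp add: poly_ring_def tvar_def)

lemma poly_ring_prod: "(\<And>x. x \<in> A \<Longrightarrow> p x \<in> poly_ring n) \<Longrightarrow> (\<Prod>x\<in>A. p x) \<in> poly_ring n"
  by (induction A rule: infinite_finite_induct) (auto intro: poly_ring_mult poly_ring_1)

lemma perm_act_diff: "bij v \<Longrightarrow> perm_act v (p - q) = perm_act v p - perm_act v q"
  using perm_act_add[of v "p - q" q] by simp

lemma perm_act_0: "bij v \<Longrightarrow> perm_act v 0 = 0"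
  using perm_act_diff[of v 0 0] by simp

lemma perm_act_prod: "bij v \<Longrightarrow> perm_act v (\<Prod>x\<in>A. p x) = (\<Prod>x\<in>A. perm_act v (p x))"
  using perm_act_const[of v 1]
  by (induction A rule: infinite_finite_induct) (auto simp: perm_act_mult)

text \<open>The witness is confined to \<open>poly_ring n\<close> because \<open>gkm\<close> asks
  for the quotient there; with \<open>e\<close> the linear form of an edge this is the GKM condition
  on that edge.\<close>

definition poly_ring_cong :: "nat \<Rightarrow> cpoly \<Rightarrow> cpoly \<Rightarrow> cpoly \<Rightarrow> bool" where
  "poly_ring_cong n e p q \<longleftrightarrow> (\<exists>s\<in>poly_ring n. p - q = e * s)"

lemma poly_ring_cong_refl: "poly_ring_cong n e p p"
  using poly_ring_0 by (auto simp: poly_ring_cong_def intro!: bexI[of _ 0])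

lemma poly_ring_cong_sym:
  assumes "poly_ring_cong n e p q"
  shows "poly_ring_cong n e q p"
proof -
  obtain s where "s \<in> poly_ring n" "p - q = e * s"
    using assms by (auto simp: poly_ring_cong_def)
  then show ?thesis unfolding poly_ring_cong_def
    using poly_ring_diff[OF poly_ring_0, of s n]
    by (intro bexI[of _ "0 - s"]) (auto simp: algebra_simps)
qed

lemma poly_ring_cong_diff:
  assumes "poly_ring_cong n e p p'" "poly_ring_cong n e q q'"
  shows "poly_ring_cong n e (p - q) (p' - q')"
proof -
  obtain s s' where "s \<in> poly_ring n" "s' \<in> poly_ring n" "p - p' = e * s" "q - q' = e * s'"
    using assms by (auto simp: poly_ring_cong_def)
  then show ?thesis unfolding poly_ring_cong_def
    by (intro bexI[of _ "s - s'"]) (auto simp: poly_ring_diff algebra_simps)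
qed

text \<open>The quotient is \<open>p * s' + s * q'\<close>, which is why membership is assumed for
  just \<open>p\<close> and \<open>q'\<close>.\<close>

lemma poly_ring_cong_mult:
  assumes "poly_ring_cong n e p p'" "poly_ring_cong n e q q'" "p \<in> poly_ring n" "q' \<in> poly_ring n"
  shows "poly_ring_cong n e (p * q) (p' * q')"
proof -
  obtain s s' where s: "s \<in> poly_ring n" "s' \<in> poly_ring n" "p - p' = e * s" "q - q' = e * s'"
    using assms by (auto simp: poly_ring_cong_def)
  have "p * q - p' * q' = p * (q - q') + (p - p') * q'"
    by (simp add: algebra_simps)
  also have "\<dots> = e * (p * s' + s * q')"
    using s by (simp add: algebra_simps)
  finally show ?thesis using s assms unfolding poly_ring_cong_def
    by (intro bexI[of _ "p * s' + s * q'"]) (auto intro!: poly_ring_add poly_ring_mult)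
qed

lemma poly_ring_cong_prod:
  assumes "\<And>x. x \<in> A \<Longrightarrow> poly_ring_cong n e (p x) (q x)"
    and "\<And>x. x \<in> A \<Longrightarrow> p x \<in> poly_ring n" "\<And>x. x \<in> A \<Longrightarrow> q x \<in> poly_ring n"
  shows "poly_ring_cong n e (\<Prod>x\<in>A. p x) (\<Prod>x\<in>A. q x)"
  using assms
  by (induction A rule: infinite_finite_induct)
    (auto intro!: poly_ring_cong_refl poly_ring_cong_mult poly_ring_prod)

subsection \<open>Length and Bruhat order on the coset representatives\<close>

lemma inv_u_perm: "inv (u_perm k) i = (if i = 1 then Suc k else if i \<in> {2..Suc k} then i - 1 else i)"
  using bij_u_perm[of k] by (intro inv_f_eq) (auto simp: bij_is_inj u_perm_one_line)

text \<open>Only the letter 1, at position k+1, is out of order: the inversions are the pairs (i,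
  k+1) with i at most k.\<close>

lemma perm_length_u_perm:
  assumes "k < n"
  shows "perm_length n (u_perm k) = k"
proof -
  have "{(i, j). i \<in> {1..n} \<and> j \<in> {1..n} \<and> i < j \<and> u_perm k i > u_perm k j}
      = (\<lambda>i. (i, Suc k)) ` {1..k}"
    using assms by (auto simp: u_perm_one_line image_iff split: if_splits)
  then show ?thesis
    by (simp add: perm_length_def card_image inj_on_def)
qed

text \<open>Steps raise the length, which gives one direction; for the other, appending one more
  simple transposition to \<open>u_perm m\<close> is itself a step.\<close>

lemma bruhat_le_u_perm_iff:
  assumes "k < n" "m < n"
  shows "bruhat_le n (u_perm k) (u_perm m) \<longleftrightarrow> k \<le> m"
proof
  assume "bruhat_le n (u_perm k) (u_perm m)"
  then have "perm_length n (u_perm k) \<le> perm_length n (u_perm m)"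
    unfolding bruhat_le_def by (induction rule: rtranclp_induct) (auto simp: bruhat_step_def)
  then show "k \<le> m" using assms by (simp add: perm_length_u_perm)
next
  assume "k \<le> m"
  then show "bruhat_le n (u_perm k) (u_perm m)" using assms(2)
  proof (induction m rule: dec_induct)
    case base
    then show ?case by (simp add: bruhat_le_def)
  next
    case (step m)
    have "bruhat_step n (u_perm m) (u_perm (Suc m))"
      unfolding bruhat_step_def using step.prems
      by (intro bexI[of _ "Suc m"] bexI[of _ "Suc (Suc m)"])
        (auto simp: perm_length_u_perm simp del: u_perm.simps, simp)
    then show ?case using step unfolding bruhat_le_def
      by (meson Suc_lessD rtranclp.rtrancl_into_rtrancl)
  qed
qed

subsection \<open>The orbits\<close>

text \<open>For a Hessenberg function, the cases k = n-2 and k = n-1 are the two sets whose sizes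
  are compared in the theorem.\<close>

definition crossing :: "(nat \<Rightarrow> nat) \<Rightarrow> nat \<Rightarrow> nat set" where
  "crossing h k = {c \<in> {1..k}. k < h c}"

definition orbit_class :: "nat \<Rightarrow> (nat \<Rightarrow> nat) \<Rightarrow> nat \<Rightarrow> nat \<Rightarrow> tuple" where
  "orbit_class n h k r = (\<lambda>w. if w permutes {1..n} \<and> r \<in> w ` {Suc k..n}
     then \<Prod>c\<in>crossing h k. tvar r - tvar (w c) else 0)"

text \<open>Every inversion of \<open>u_perm k\<close> involves the letter 1, at position k+1, and
  the letter c+1 stands at position c for c at most k.\<close>

lemma S_set_eq:
  assumes "k < n"
  shows "S_set n h k = (\<lambda>c. (1, Suc c)) ` crossing h k"
proof (rule set_eqI)
  fix x :: "nat \<times> nat"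
  obtain a b where x: "x = (a, b)" by fastforce
  show "x \<in> S_set n h k \<longleftrightarrow> x \<in> (\<lambda>c. (1, Suc c)) ` crossing h k"
  proof
    assume "x \<in> S_set n h k"
    then have "a = 1 \<and> b = Suc (b - 1) \<and> b - 1 \<in> crossing h k"
      unfolding x by (auto simp: S_set_def inv_u_perm crossing_def split: if_splits)
    then show "x \<in> (\<lambda>c. (1, Suc c)) ` crossing h k"
      unfolding x by (metis image_eqI)
  next
    assume "x \<in> (\<lambda>c. (1, Suc c)) ` crossing h k"
    then show "x \<in> S_set n h k"
      using assms unfolding x by (auto simp: S_set_def inv_u_perm crossing_def)
  qed
qed

lemma card_S_set: "k < n \<Longrightarrow> card (S_set n h k) = card (crossing h k)"
  by (simp add: S_set_eq card_image inj_on_def)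

text \<open>In w = y u_m the letter 1 stands at position m+1, so the Bruhat condition says that this
  position exceeds k. For c at most k, hence at most m, y(c+1) = w(c).\<close>

lemma f_class_eq:
  assumes k: "k < n"
  shows "f_class n h k = orbit_class n h k 1"
proof
  fix w
  show "f_class n h k w = orbit_class n h k 1 w"
  proof (cases "w permutes {1..n}")
    case False
    then show ?thesis by (simp add: f_class_def orbit_class_def)
  next
    case True
    obtain y m where ym: "y \<in> stab_one n" "m < n" "w = y \<circ> u_perm m"
      using coset_decomp_exists[OF True] k by auto
    have "w (Suc m) = 1"
      using ym by (auto simp: stab_one_def u_perm_one_line)
    then have "1 \<in> w ` {Suc k..n} \<longleftrightarrow> Suc m \<in> {Suc k..n}"
      using permutes_inj[OF True] by (metis inj_image_mem_iff)
    moreover have "(\<Prod>(a, b)\<in>S_set n h k. tvar (y a) - tvar (y b))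
        = (\<Prod>c\<in>crossing h k. tvar 1 - tvar (w c))" if "k \<le> m"
    proof -
      have "(\<Prod>(a, b)\<in>S_set n h k. tvar (y a) - tvar (y b))
          = (\<Prod>c\<in>crossing h k. tvar (y 1) - tvar (y (Suc c)))"
        by (simp add: S_set_eq[OF k] prod.reindex inj_on_def)
      also have "\<dots> = (\<Prod>c\<in>crossing h k. tvar 1 - tvar (w c))"
        using ym that by (intro prod.cong) (auto simp: stab_one_def crossing_def u_perm_one_line)
      finally show ?thesis .
    qed
    ultimately show ?thesis
      using True ym(2) f_class_apply[OF ym(1,2), of h k] k unfolding ym(3)[symmetric]
      by (simp add: bruhat_le_u_perm_iff orbit_class_def)
  qed
qed

lemma dot_orbit_class:
  assumes v: "v permutes {1..n}"
  shows "dot n v (orbit_class n h k r) = orbit_class n h k (v r)"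
proof
  fix w
  have bv: "bij v" using v by (rule permutes_bij)
  show "dot n v (orbit_class n h k r) w = orbit_class n h k (v r) w"
  proof (cases "w permutes {1..n}")
    case True
    have "r \<in> (inv v \<circ> w) ` {Suc k..n} \<longleftrightarrow> v r \<in> w ` {Suc k..n}"
      using permutes_inv_eq[OF v] by (simp add: image_iff eq_commute[of r] eq_commute[of "v r"])
    moreover have "inv v \<circ> w permutes {1..n}"
      using v True by (intro permutes_compose permutes_inv)
    ultimately show ?thesis
      using True permutes_inverses[OF v]
      by (simp add: dot_def orbit_class_def perm_act_0[OF bv] perm_act_prod[OF bv]
          perm_act_diff[OF bv] perm_act_tvar[OF bv])
  qed (simp add: dot_def orbit_class_def)
qed

lemma orbit_orbit_class:
  assumes "r \<in> {1..n}"
  shows "orbit n (orbit_class n h k r) = orbit_class n h k ` {1..n}"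
proof
  show "orbit n (orbit_class n h k r) \<subseteq> orbit_class n h k ` {1..n}"
    using assms by (auto simp: orbit_def dot_orbit_class) (metis atLeastAtMost_iff image_eqI permutes_in_image)
next
  show "orbit_class n h k ` {1..n} \<subseteq> orbit n (orbit_class n h k r)"
  proof
    fix F assume "F \<in> orbit_class n h k ` {1..n}"
    then obtain s where s: "s \<in> {1..n}" "F = orbit_class n h k s" by blast
    have t: "transpose r s permutes {1..n}" using assms s by (intro permutes_swap_id)
    then show "F \<in> orbit n (orbit_class n h k r)"
      using s dot_orbit_class[OF t, of h k r] unfolding orbit_def by force
  qed
qed

text \<open>Along an edge the products over \<open>crossing h k\<close> agree modulo
  \<open>e\<close>, which suffices unless the edge leaves the support. In that case j is at most k
  and k < i, so j is a crossing position, and r is one of the two swapped letters; the factor at j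
  is then 0 or plus or minus \<open>e\<close>.\<close>

lemma orbit_class_gkm:
  assumes k: "k < n" and r: "r \<in> {1..n}"
  shows "orbit_class n h k r \<in> gkm n h"
  unfolding gkm_def
proof (intro CollectI conjI allI impI)
  fix w assume "\<not> w permutes {1..n}"
  then show "orbit_class n h k r w = 0" by (simp add: orbit_class_def)
next
  have prod_mem: "(\<Prod>c\<in>crossing h k. tvar r - tvar (w c)) \<in> poly_ring n"
    "c \<in> crossing h k \<Longrightarrow> tvar r - tvar (w c) \<in> poly_ring n" if "w permutes {1..n}" for w c
  proof -
    have "w c \<in> {1..n}" if "c \<in> crossing h k" for c
      using that permutes_in_image[OF \<open>w permutes {1..n}\<close>, of c] k by (auto simp: crossing_def)
    then show "(\<Prod>c\<in>crossing h k. tvar r - tvar (w c)) \<in> poly_ring n"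
      "c \<in> crossing h k \<Longrightarrow> tvar r - tvar (w c) \<in> poly_ring n"
      using r by (auto intro!: poly_ring_prod poly_ring_diff poly_ring_tvar)
  qed
  show "orbit_class n h k r w \<in> poly_ring n" if "w permutes {1..n}" for w
    using prod_mem(1)[OF that] by (simp add: orbit_class_def poly_ring_0)
  fix w assume w: "w permutes {1..n}"
  show "\<forall>(i, j)\<in>Nh_minus n h w. \<exists>q\<in>poly_ring n.
    orbit_class n h k r w - orbit_class n h k r (w \<circ> transpose i j) = (tvar (w i) - tvar (w j)) * q"
  proof (intro ballI, clarify)
    fix i j assume "(i, j) \<in> Nh_minus n h w"
    then have ij: "i \<in> {1..n}" "j \<in> {1..n}" "j < i" "i \<le> h j"
      by (auto simp: Nh_minus_def)
    define e where "e = tvar (w i) - tvar (w j)"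
    define w' where "w' = w \<circ> transpose i j"
    define P where "P w = (\<Prod>c\<in>crossing h k. tvar r - tvar (w c))" for w
    have w': "w' permutes {1..n}"
      unfolding w'_def using ij w by (intro permutes_compose permutes_swap_id)
    have tvar_cong: "poly_ring_cong n e (tvar (w c)) (tvar (w' c))" for c
      unfolding poly_ring_cong_def w'_def transpose_def e_def
      using poly_ring_0[of n] poly_ring_1[of n] poly_ring_diff[OF poly_ring_0 poly_ring_1, of n]
      by (cases "c = i"; cases "c = j") (auto intro: bexI[of _ 0] bexI[of _ 1] bexI[of _ "0 - 1"])
    have P_cong: "poly_ring_cong n e (P w) (P w')"
      unfolding P_def using prod_mem(2)[OF w] prod_mem(2)[OF w']
      by (intro poly_ring_cong_prod poly_ring_cong_diff poly_ring_cong_refl tvar_cong)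
    have "poly_ring_cong n e (orbit_class n h k r w) (orbit_class n h k r w')"
    proof (cases "r \<in> w ` {Suc k..n} \<longleftrightarrow> r \<in> w' ` {Suc k..n}")
      case True
      then show ?thesis using P_cong w w'
        by (auto simp: orbit_class_def P_def poly_ring_cong_refl)
    next
      case False
      have "w' ` {Suc k..n} = w ` {Suc k..n}" if "i \<in> {Suc k..n} \<longleftrightarrow> j \<in> {Suc k..n}"
        unfolding w'_def image_comp[symmetric] using that by simp
      then have "\<not> (i \<in> {Suc k..n} \<longleftrightarrow> j \<in> {Suc k..n})" using False by blast
      then have j: "j \<in> crossing h k" "i \<in> {Suc k..n}" "j \<notin> {Suc k..n}"
        using ij by (auto simp: crossing_def)
      have rr: "r = w i \<or> r = w j"
      proof (rule ccontr)
        assume "\<not> ?thesis"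
        then have "r = w c \<longleftrightarrow> r = w' c" for c
          by (auto simp: w'_def transpose_def)
        then show False using False by auto
      qed
      have fin: "finite (crossing h k)" by (simp add: crossing_def)
      \<comment> \<open>Either endpoint may be the one in the support, so the product is shown to
        vanish modulo \<open>e\<close> at both.\<close>
      have P_0: "poly_ring_cong n e (P x) 0" if "x permutes {1..n}" "x j = w j \<or> x j = w i" for x
      proof -
        define Q where "Q = (\<Prod>c\<in>crossing h k - {j}. tvar r - tvar (x c))"
        have Q: "Q \<in> poly_ring n" unfolding Q_def
          using prod_mem(2)[OF that(1)] by (intro poly_ring_prod) auto
        have PQ: "P x = (tvar r - tvar (x j)) * Q"
          unfolding P_def Q_def by (rule prod.remove[OF fin j(1)])
        have "(tvar r - tvar (x j)) \<in> {0, e, e * (0 - 1)}"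
          using rr that(2) by (auto simp: e_def)
        then show ?thesis unfolding poly_ring_cong_def PQ
          using Q poly_ring_0[of n] poly_ring_diff[OF poly_ring_0 Q]
          by (auto intro: bexI[of _ 0] bexI[of _ Q] bexI[of _ "0 - Q"])
      qed
      have "poly_ring_cong n e (P w) 0" "poly_ring_cong n e 0 (P w')"
        using P_0[OF w] poly_ring_cong_sym[OF P_0[OF w']] by (auto simp: w'_def)
      then show ?thesis using False w w' by (auto simp: orbit_class_def P_def)
    qed
    then show "\<exists>q\<in>poly_ring n. orbit_class n h k r w - orbit_class n h k r (w \<circ> transpose i j)
        = (tvar (w i) - tvar (w j)) * q"
      unfolding poly_ring_cong_def e_def w'_def .
  qed
qed

subsection \<open>Linear independence\<close>

lemma upward_closed_eq_interval:
  fixes A :: "nat set"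
  assumes "A \<subseteq> {1..m}" and up: "\<And>i j. i \<in> A \<Longrightarrow> i \<le> j \<Longrightarrow> j \<le> m \<Longrightarrow> j \<in> A"
  shows "A = {Suc m - card A..m}"
proof (cases "A = {}")
  case False
  have fin: "finite A" using assms(1) finite_subset by blast
  define l where "l = Min A"
  have "l \<in> A" unfolding l_def using False fin by simp
  have "A = {l..m}"
  proof
    show "A \<subseteq> {l..m}" using assms(1) fin by (auto simp: l_def)
    show "{l..m} \<subseteq> A" using up[OF \<open>l \<in> A\<close>] by auto
  qed
  then show ?thesis using \<open>l \<in> A\<close> by (metis Suc_diff_le atLeastAtMost_iff card_atLeastAtMost diff_diff_cancel le_SucI)
qed simp

text \<open>As h is nondecreasing, the crossing positions form a final segment of {1..k}, determined
  by its size. Hence the degree alone fixes the factors of the classes.\<close>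

lemma crossing_eq:
  assumes "hessenberg n h" "k < n"
  shows "crossing h k = {Suc k - card (crossing h k)..k}"
proof (rule upward_closed_eq_interval)
  show "crossing h k \<subseteq> {1..k}" by (auto simp: crossing_def)
  fix i j assume "i \<in> crossing h k" "i \<le> j" "j \<le> k"
  then show "j \<in> crossing h k"
    using assms unfolding hessenberg_def crossing_def
    by (auto dest!: mono_onD[where r = i and s = j])
qed

lemma tvar_diff_nonzero: "i \<noteq> j \<Longrightarrow> tvar i - tvar j \<noteq> 0"
  using tvar_inj by auto

text \<open>Passing from letters r to positions i leaves two terms for k = n-2 and a single one for
  k = n-1.\<close>

lemma sum_orbit_class:
  assumes w: "w permutes {1..n}"
  shows "(\<Sum>r\<in>{1..n}. a r * orbit_class n h k r w)
    = (\<Sum>i\<in>{Suc k..n}. a (w i) * (\<Prod>c\<in>crossing h k. tvar (w i) - tvar (w c)))"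
proof -
  have sub: "w ` {Suc k..n} \<subseteq> {1..n}"
    using permutes_in_image[OF w] by force
  have "(\<Sum>r\<in>{1..n}. a r * orbit_class n h k r w)
    = (\<Sum>r\<in>w ` {Suc k..n}. a r * (\<Prod>c\<in>crossing h k. tvar r - tvar (w c)))"
    using sub w by (intro sum.mono_neutral_cong_right) (auto simp: orbit_class_def)
  then show ?thesis
    using permutes_inj_on[OF w] by (simp add: sum.reindex)
qed

text \<open>Swapping X and C changes only the last term, so it kills the coefficient of q - c. Then
  replacing one letter by Z, with the other fixed, leaves a relation linear in the fixed letter; it
  holds for both C and X, so its slope and its constant term vanish.\<close>

lemma four_relations:
  fixes \<alpha> :: "'a :: idom"
  assumes E: "\<And>x c. (x, c) \<in> {(X, C), (C, X), (Z, C), (Z, X)} \<Longrightarrow>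
      \<alpha> * (p - c) * (p - x) + \<beta> * (q - c) * (q - x) + \<gamma> * (q - c) = 0"
    and ne: "X \<noteq> C" "Z \<noteq> X" "Z \<noteq> C" "p \<noteq> q"
  shows "\<beta> = 0 \<and> \<gamma> = 0"
proof -
  have "\<gamma> * (X - C) = 0" using E[of X C] E[of C X] by (simp add: algebra_simps) algebra
  then have g: "\<gamma> = 0" using ne by simp
  have "(\<alpha> * (p - C) + \<beta> * (q - C)) * (Z - X) = 0"
    using E[of X C] E[of Z C] by simp algebra
  then have 1: "\<alpha> * (p - C) + \<beta> * (q - C) = 0" using ne by simp
  have "(\<alpha> * (p - X) + \<beta> * (q - X)) * (Z - C) = 0"
    using E[of C X] E[of Z X] by simp algebra
  then have 2: "\<alpha> * (p - X) + \<beta> * (q - X) = 0" using ne by simp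
  have "(\<alpha> + \<beta>) * (X - C) = 0" using 1 2 by algebra
  then have "\<alpha> + \<beta> = 0" using ne by simp
  then have "\<beta> * (q - p) = 0" using 1 by algebra
  then show ?thesis using ne g by simp
qed

lemma orbit_class_independent:
  fixes a b :: "nat \<Rightarrow> cpoly"
  assumes n: "n \<ge> 3" and h: "hessenberg n h" "h 1 < n - 1"
    and card: "card (crossing h (n - 2)) = d" "card (crossing h (n - 1)) = d" "d \<ge> 2"
    and rel: "\<And>w. w permutes {1..n} \<Longrightarrow>
      (\<Sum>r\<in>{1..n}. a r * orbit_class n h (n - 2) r w)
      + (\<Sum>r\<in>{1..n}. b r * orbit_class n h (n - 1) r w) = 0"
    and q: "q \<in> {1..n}"
  shows "a q = 0 \<and> b q = 0"
proof -
  \<comment> \<open>\<open>k\<close> is the first crossing position for n-2, and \<open>M\<close>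
    collects the positions other than n-2 that both crossing sets share. The sets differ only in
    having \<open>k\<close> or n-1.\<close>
  define k where "k = n - 1 - d"
  define M where "M = {Suc k..n - 3}"
  have c1: "crossing h (n - 2) = {n - 1 - d..n - 2}"
    using crossing_eq[OF h(1), of "n - 2"] card n by (simp add: Suc_diff_le numeral_3_eq_3)
  have c2: "crossing h (n - 1) = {n - d..n - 1}"
    using crossing_eq[OF h(1), of "n - 1"] card n by simp
  \<comment> \<open>Since h(1) < n-1, position 1 does not cross; hence 1 < k and the subtraction
    defining \<open>k\<close> is not truncated. The bound on d gives k < n-2.\<close>
  have "1 \<notin> {n - 1 - d..n - 2}" "0 \<notin> {n - 1 - d..n - 2}"
    unfolding c1[symmetric] using h(2) by (auto simp: crossing_def)
  then have k: "1 < k" "k < n - 2" "n = k + 1 + d"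
    using n card(3) unfolding k_def by auto
  have J1: "crossing h (n - 2) = insert k (insert (n - 2) M)"
    and J2: "crossing h (n - 1) = insert (n - 1) (insert (n - 2) M)"
    unfolding c1 c2 M_def using k card(3) by auto
  have M: "finite M" "k \<notin> M" "n - 2 \<notin> M" "n - 1 \<notin> M" "n \<notin> M" "1 \<notin> M"
    using k unfolding M_def by auto
  have T: "{Suc (n - 2)..n} = {n - 1, n}" "{Suc (n - 1)..n} = {n}" using n by auto
  \<comment> \<open>With q at position n, both classes indexed by q are nonzero at
    \<open>w\<close>.\<close>
  define w where "w = transpose n q"
  have w: "w permutes {1..n}" "w n = q"
    using q n unfolding w_def by (auto intro: permutes_swap_id)
  have inj: "w i = w j \<longleftrightarrow> i = j" for i j using permutes_inj[OF w(1)] by (auto dest: injD)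
  define p where "p = w (n - 1)"
  define R where "R s = (\<Prod>c\<in>M. tvar s - tvar (w c))" for s
  \<comment> \<open>The factors over \<open>M\<close> are absorbed into \<open>R\<close>, which
    ignores the letters at positions 1, k and n-2. The factor q - p comes from position n-1, which
    crosses only for n-1.\<close>
  have expand: "a p * R p * (tvar p - tvar (v (n - 2))) * (tvar p - tvar (v k))
      + a q * R q * (tvar q - tvar (v (n - 2))) * (tvar q - tvar (v k))
      + b q * R q * (tvar q - tvar p) * (tvar q - tvar (v (n - 2))) = 0"
    if v: "v permutes {1..n}" and fixed: "\<And>i. i \<notin> {1, k, n - 2} \<Longrightarrow> v i = w i" for v
  proof -
    have vR: "(\<Prod>c\<in>M. tvar s - tvar (v c)) = R s" for s
      unfolding R_def using M by (intro prod.cong refl) (metis fixed insertE singletonD)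
    have vpq: "v (n - 1) = p" "v n = q"
      using k card(3) fixed[of "n - 1"] fixed[of n] w(2) by (auto simp: p_def)
    have "k \<noteq> n - 2" "n - 1 \<noteq> n - 2" "n - 1 \<noteq> n" using k by auto
    then show ?thesis
      using rel[OF v] M unfolding sum_orbit_class[OF v] T J1 J2
      by (simp add: vR vpq vpq[simplified] algebra_simps)
  qed
  let ?X = "tvar (w k)" and ?C = "tvar (w (n - 2))" and ?Z = "tvar (w 1)"
  have "a q * R q = 0 \<and> b q * R q * (tvar q - tvar p) = 0"
  proof (rule four_relations)
    fix x c assume "(x, c) \<in> {(?X, ?C), (?C, ?X), (?Z, ?C), (?Z, ?X)}"
    then consider "(x, c) = (?X, ?C)" | "(x, c) = (?C, ?X)" | "(x, c) = (?Z, ?C)" | "(x, c) = (?Z, ?X)"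
      by blast
    \<comment> \<open>Each pair is realized by rearranging the letters at positions 1, k and n-2: by
      nothing, a transposition, or a 3-cycle.\<close>
    then obtain v where "v permutes {1..n}" "\<And>i. i \<notin> {1, k, n - 2} \<Longrightarrow> v i = w i"
        "x = tvar (v k)" "c = tvar (v (n - 2))"
    proof cases
      case 1
      then show ?thesis using that[of w] w by auto
    next
      case 2
      have "w \<circ> transpose k (n - 2) permutes {1..n}"
        using k w by (intro permutes_compose permutes_swap_id) auto
      then show ?thesis using that[of "w \<circ> transpose k (n - 2)"] 2 by (auto simp: transpose_def)
    next
      case 3
      have "w \<circ> transpose k 1 permutes {1..n}"
        using k w by (intro permutes_compose permutes_swap_id) auto
      then show ?thesis using that[of "w \<circ> transpose k 1"] 3 k by (auto simp: transpose_def)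
    next
      case 4
      have "w \<circ> transpose k (n - 2) \<circ> transpose k 1 permutes {1..n}"
        using k w by (intro permutes_compose permutes_swap_id) auto
      then show ?thesis using that[of "w \<circ> transpose k (n - 2) \<circ> transpose k 1"] 4 k
        by (auto simp: transpose_def)
    qed
    then show "a p * R p * (tvar p - c) * (tvar p - x) + a q * R q * (tvar q - c) * (tvar q - x)
        + b q * R q * (tvar q - tvar p) * (tvar q - c) = 0"
      using expand by blast
  next
    show "?X \<noteq> ?C" "?Z \<noteq> ?X" "?Z \<noteq> ?C" "tvar p \<noteq> tvar q"
      using k inj by (auto dest!: tvar_inj simp: p_def w(2)[symmetric])
  qed
  moreover have "R q \<noteq> 0"
    unfolding R_def w(2)[symmetric] using M inj by (auto simp: prod_zero_iff dest!: tvar_inj)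
  moreover have "tvar q - tvar p \<noteq> 0"
    using inj n by (intro tvar_diff_nonzero) (auto simp: p_def w(2)[symmetric])
  ultimately show ?thesis by simp
qed

theorem theorem6p2:
  fixes n :: nat and h :: "nat \<Rightarrow> nat" and f g :: "nat \<Rightarrow> tuple"
  assumes "n \<ge> 3"
    and "hessenberg n h"
    and "hess_connected n h"
    and "card {i \<in> {1..n}. i < n - 1 \<and> h i \<ge> n - 1} = card {i \<in> {1..n}. i < n \<and> h i = n}"
    and "h 1 < n - 1"
    and "\<And>i. i < n \<Longrightarrow> f i = dot n (inv (u_perm i)) (f_class n h (n - 2))"
    and "\<And>i. i < n \<Longrightarrow> g i = dot n (inv (u_perm i)) (f_class n h (n - 1))"
    and "class_degree n (f 0) = class_degree n (g 0)"
    and "class_degree n (g 0) \<ge> 2"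
  shows "f ` {..<n} \<union> g ` {..<n} = orbit n (f 0) \<union> orbit n (g 0)
       \<and> f ` {..<n} \<union> g ` {..<n} \<subseteq> gkm n h
       \<and> lin_independent n ({..<n} <+> {..<n}) (case_sum f g)"
proof -
  \<comment> \<open>The inverse of \<open>u_perm i\<close> sends 1 to i+1, so the n images
    correspond to the n letters r.\<close>
  have dot_f_class: "dot n (inv (u_perm i)) (f_class n h k) = orbit_class n h k (Suc i)"
    if "i < n" "k < n" for i k
    using that dot_orbit_class[OF permutes_inv[OF u_perm_permutes[OF that(1)]], of h k 1]
    by (simp add: f_class_eq inv_u_perm)
  have f: "f i = orbit_class n h (n - 2) (Suc i)" and g: "g i = orbit_class n h (n - 1) (Suc i)"
    if "i < n" for i
    using that assms(1,6,7) dot_f_class by auto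
  have f_im: "f ` {..<n} = orbit_class n h (n - 2) ` {1..n}"
    and g_im: "g ` {..<n} = orbit_class n h (n - 1) ` {1..n}"
    using f g unfolding image_Suc_lessThan[symmetric] image_image by (auto intro!: image_cong)
  have orbits: "orbit n (f 0) = f ` {..<n}" "orbit n (g 0) = g ` {..<n}"
    unfolding f_im g_im using assms(1) f[of 0] g[of 0] by (auto simp: orbit_orbit_class)
  have gkm: "f ` {..<n} \<union> g ` {..<n} \<subseteq> gkm n h"
    unfolding f_im g_im using assms(1) by (auto intro!: orbit_class_gkm)
  have deg: "class_degree n (orbit_class n h k (Suc 0)) = card (crossing h k)" if "k < n" for k
    using f_class_degree[OF that, of h] that by (simp add: f_class_eq card_S_set)
  have card: "card (crossing h (n - 2)) = card (crossing h (n - 1))" "card (crossing h (n - 1)) \<ge> 2"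
    using assms(1,8,9) f[of 0] g[of 0] deg by auto
  have "lin_independent n ({..<n} <+> {..<n}) (case_sum f g)"
    unfolding lin_independent_def
  proof (intro allI impI)
    fix c :: "nat + nat \<Rightarrow> cpoly"
    assume c: "(\<forall>i\<in>{..<n} <+> {..<n}. c i \<in> poly_ring n) \<and>
      (\<forall>w. w permutes {1..n} \<longrightarrow> (\<Sum>i\<in>{..<n} <+> {..<n}. c i * case_sum f g i w) = 0)"
    \<comment> \<open>The class with index i belongs to the letter i+1, hence the coefficients at
      r-1 below.\<close>
    have shift: "(\<Sum>r\<in>{1..n}. F r) = (\<Sum>i<n. F (Suc i))" for F :: "nat \<Rightarrow> cpoly"
      by (simp add: sum.atLeast1_atMost_eq)
    have rel: "(\<Sum>r\<in>{1..n}. c (Inl (r - 1)) * orbit_class n h (n - 2) r w)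
      + (\<Sum>r\<in>{1..n}. c (Inr (r - 1)) * orbit_class n h (n - 1) r w) = 0" if "w permutes {1..n}" for w
      using c that f g unfolding shift by (simp add: sum.Plus)
    have zero: "c (Inl (r - 1)) = 0 \<and> c (Inr (r - 1)) = 0" if "r \<in> {1..n}" for r
      using orbit_class_independent[where a = "\<lambda>r. c (Inl (r - 1))" and b = "\<lambda>r. c (Inr (r - 1))",
          OF assms(1,2,5) card(1) refl card(2) rel that] .
    show "\<forall>i\<in>{..<n} <+> {..<n}. c i = 0"
      using zero[of "Suc _"] by (auto elim!: PlusE)
  qed
  then show ?thesis using orbits gkm by simp
qed

end
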